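(* Let $a<b$, $A,B$ be real numbers and let $L\in C([a,b]\times\mathbb{R}\times\mathbb{R})$ be locally Hölder continuous: for each compact $G\subset[a,b]\times\mathbb{R}\times\mathbb{R}$ there exist $C=C(G)>0$ and $\alpha=\alpha(G)>0$ such that $|L(x_1,u_1,v_1)-L(x_2,u_2,v_2)|\le C(|x_1-x_2|+|u_1-u_2|+|v_1-v_2|)^{\alpha}$ for all $(x_1,u_1,v_1),(x_2,u_2,v_2)\in G$. Let $f,g\in C^1([a,b])$ with $f<g$, let $K:=\{(x,u)\in[a,b]\times\mathbb{R}:f(x)\le u\le g(x)\}$, let $u\in W^{1,1}([a,b])$ with $\mathcal{J}_L(u;[a,b])$ finite, let $c:=|\mathcal{J}_L(u;[a,b])|+1$ and let $\delta_0>0$. If $u\in\mathcal{A}_{f,g}$ and $\mathcal{J}_L(u;[a,b])\le\mathcal{J}_L(v;[a,b])$ for all $v\in\mathcal{A}_{f,g}$, then $u\in\mathcal{L}_\omega(L,K,c,\delta_0)$, where $\omega:[0,\infty[\times[0,\infty[\to[0,\infty[$ is given by $$\omega(k,\varepsilon):=C_0\Big[\big(\omega_f(\varepsilon)+\omega_{f'}(\varepsilon)+k\varepsilon\big)^{\alpha_0}+\big(\omega_g(\varepsilon)+\omega_{g'}(\varepsilon)+k\varepsilon\big)^{\alpha_0}\Big],$$ $\omega_f,\omega_{f'},\omega_g,\omega_{g'}$ are the moduli of continuity of $f,f',g,g'$ respectively, and $C_0,\alpha_0>0$ are the Hölder constant and exponent $C(G),\alpha(G)$ of $L$ for $G=[a,b]\times[-M_1,M_1]\times[-M_2,M_2]$,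 with $M_2:=\max\{\|f'\|_\infty,\|g'\|_\infty\}$ and $M_1:=\max\{\|f\|_\infty,\|g\|_\infty\}+M_2(b-a)$.
   Context: Functions in $W^{1,1}([a,b])$ are identified with their absolutely continuous representatives. $\mathcal{J}_L(u;[a,b]):=\int_a^bL(x,u(x),u'(x))\,dx$ and $\mathcal{A}_{f,g}:=\{u\in W^{1,1}([a,b]):u(a)=A,\ u(b)=B,\ f\le u\le g\}$. $\|h\|_\infty:=\sup_{x\in[a,b]}|h(x)|$; the modulus of continuity of $h\in C([a,b])$ is $\omega_h(\varepsilon)=\sup\{|h(x)-h(y)|:x,y\in[a,b],|x-y|\le\varepsilon\}$. For $u\in W^{1,1}([a,b])$ and $s,t\in[a,b]$ with $s<t$, $k_u(s,t):=\frac{u(s)-u(t)}{s-t}$, and $u_{s,t}\in W^{1,1}([a,b])$ is defined by $u_{s,t}(x)=u(s)+k_u(s,t)(x-s)$ if $x\in]s,t[$ and $u_{s,t}(x)=u(x)$ if $x\in[a,b]\setminus]s,t[$. For a compact $K\subset[a,b]\times\mathbb{R}$, a function $\omega:[0,\infty[\times[0,\infty[\to[0,\infty[$ increasing (i.e. non-decreasing) in both arguments with $\omega(k,0)=0$ for all $k$, $c>0$ and $\delta_0>0$, the class $\mathcal{L}_\omega(L,K,c,\delta_0)$ is the set of $u\in W^{1,1}([a,b])$ such that: (A1) $\{(x,u(x)):x\in[a,b]\}\subset K$; (A2) $\mathcal{J}_L(u;[a,b])\le c$; (A3) for every $s,t\in[a,b]$ with $s<t$ and $|s-t|\le\delta_0$,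 $\mathcal{J}_L(u;[a,b])\le\mathcal{J}_L(u_{s,t};[a,b])+\omega(|k_u(s,t)|,|s-t|)\,|s-t|$. *)

theory Defs
  imports "HOL-Analysis.Analysis"
begin

text \<open>
  Functions on \<open>[a,b]\<close> are modelled by total functions \<open>real \<Rightarrow> real\<close>; every notion below depends
  only on their values on \<open>{a..b}\<close> (derivatives are taken within \<open>{a..b}\<close>).

  An element of \<open>W\<^sup>1\<^sup>,\<^sup>1([a,b])\<close> is identified with its absolutely continuous representative, so
  the space is the set of absolutely continuous functions. The families below may
  contain degenerate intervals \<open>s i = t i\<close>, which contribute nothing.
\<close>

definition W11 :: "real \<Rightarrow> real \<Rightarrow> (real \<Rightarrow> real) set" where
  "W11 a b = {u. \<forall>\<epsilon>>0. \<exists>\<delta>>0. \<forall>(n::nat) s t.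
      (\<forall>i<n. a \<le> s i \<and> s i \<le> t i \<and> t i \<le> b) \<and>
      (\<forall>i<n. \<forall>j<n. i \<noteq> j \<longrightarrow> {s i<..<t i} \<inter> {s j<..<t j} = {}) \<and>
      (\<Sum>i<n. t i - s i) < \<delta>
      \<longrightarrow> (\<Sum>i<n. \<bar>u (t i) - u (s i)\<bar>) < \<epsilon>}"

text \<open>
  The weak derivative of an absolutely continuous function is its classical derivative, which
  exists almost everywhere; the unspecified value of \<^const>\<open>vector_derivative\<close> on the remaining
  null set does not affect the integrals below.
\<close>

definition lagrangian_along ::
    "(real \<times> real \<times> real \<Rightarrow> real) \<Rightarrow> (real \<Rightarrow> real) \<Rightarrow> real \<Rightarrow> real \<Rightarrow> real \<Rightarrow> real" where
  "lagrangian_along L u a b x = L (x, u x, vector_derivative u (at x within {a..b}))"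

text \<open>
  The Lebesgue integral of the Lagrangian along \<open>u\<close>, as an extended real: the integral of the
  positive part minus the integral of the negative part (\<^const>\<open>ennreal\<close> truncates negative
  reals to \<open>0\<close>). If both are infinite the value is \<open>\<infinity> - \<infinity> = \<infinity>\<close>, so that functions for
  which the integral is undefined impose no condition on a minimizer.
\<close>

definition energy ::
    "(real \<times> real \<times> real \<Rightarrow> real) \<Rightarrow> (real \<Rightarrow> real) \<Rightarrow> real \<Rightarrow> real \<Rightarrow> ereal" where
  "energy L u a b =
      enn2ereal (\<integral>\<^sup>+x\<in>{a..b}. ennreal (lagrangian_along L u a b x) \<partial>lebesgue) -
      enn2ereal (\<integral>\<^sup>+x\<in>{a..b}. ennreal (- lagrangian_along L u a b x) \<partial>lebesgue)"

definition admissible ::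
    "real \<Rightarrow> real \<Rightarrow> real \<Rightarrow> real \<Rightarrow> (real \<Rightarrow> real) \<Rightarrow> (real \<Rightarrow> real) \<Rightarrow> (real \<Rightarrow> real) set" where
  "admissible a b A B f g =
      {u \<in> W11 a b. u a = A \<and> u b = B \<and> (\<forall>x\<in>{a..b}. f x \<le> u x \<and> u x \<le> g x)}"

definition holder_on ::
    "(real \<times> real \<times> real) set \<Rightarrow> (real \<times> real \<times> real \<Rightarrow> real) \<Rightarrow> real \<Rightarrow> real \<Rightarrow> bool" where
  "holder_on G L C \<alpha> \<longleftrightarrow>
      (\<forall>x1 u1 v1 x2 u2 v2. (x1, u1, v1) \<in> G \<and> (x2, u2, v2) \<in> G \<longrightarrow>
        \<bar>L (x1, u1, v1) - L (x2, u2, v2)\<bar>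
          \<le> C * (\<bar>x1 - x2\<bar> + \<bar>u1 - u2\<bar> + \<bar>v1 - v2\<bar>) powr \<alpha>)"

definition locally_holder ::
    "real \<Rightarrow> real \<Rightarrow> (real \<times> real \<times> real \<Rightarrow> real) \<Rightarrow> bool" where
  "locally_holder a b L \<longleftrightarrow>
      (\<forall>G. compact G \<and> G \<subseteq> {a..b} \<times> UNIV \<times> UNIV \<longrightarrow> (\<exists>C>0. \<exists>\<alpha>>0. holder_on G L C \<alpha>))"

definition sup_norm :: "real \<Rightarrow> real \<Rightarrow> (real \<Rightarrow> real) \<Rightarrow> real" where
  "sup_norm a b h = (SUP x\<in>{a..b}. \<bar>h x\<bar>)"

definition modulus :: "real \<Rightarrow> real \<Rightarrow> (real \<Rightarrow> real) \<Rightarrow> real \<Rightarrow> real" where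
  "modulus a b h \<epsilon> = Sup {\<bar>h x - h y\<bar> |x y. x \<in> {a..b} \<and> y \<in> {a..b} \<and> \<bar>x - y\<bar> \<le> \<epsilon>}"

definition slope :: "(real \<Rightarrow> real) \<Rightarrow> real \<Rightarrow> real \<Rightarrow> real" where
  "slope u s t = (u s - u t) / (s - t)"

definition affine_repl :: "(real \<Rightarrow> real) \<Rightarrow> real \<Rightarrow> real \<Rightarrow> real \<Rightarrow> real" where
  "affine_repl u s t x = (if x \<in> {s<..<t} then u s + slope u s t * (x - s) else u x)"

text \<open>The requirements on the parameters under which the class \<open>quasi_min_class\<close> is defined.\<close>

definition class_data ::
    "real \<Rightarrow> real \<Rightarrow> (real \<Rightarrow> real \<Rightarrow> real) \<Rightarrow> (real \<times> real) set \<Rightarrow> real \<Rightarrow> real \<Rightarrow> bool" where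
  "class_data a b \<omega> K c \<delta>0 \<longleftrightarrow>
      compact K \<and> K \<subseteq> {a..b} \<times> UNIV \<and> c > 0 \<and> \<delta>0 > 0 \<and>
      (\<forall>k\<ge>0. \<forall>\<epsilon>\<ge>0. \<omega> k \<epsilon> \<ge> 0) \<and>
      (\<forall>k k' \<epsilon> \<epsilon>'. 0 \<le> k \<and> k \<le> k' \<and> 0 \<le> \<epsilon> \<and> \<epsilon> \<le> \<epsilon>' \<longrightarrow> \<omega> k \<epsilon> \<le> \<omega> k' \<epsilon>') \<and>
      (\<forall>k\<ge>0. \<omega> k 0 = 0)"

definition quasi_min_class ::
    "real \<Rightarrow> real \<Rightarrow> (real \<Rightarrow> real \<Rightarrow> real) \<Rightarrow> (real \<times> real \<times> real \<Rightarrow> real) \<Rightarrow>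
     (real \<times> real) set \<Rightarrow> real \<Rightarrow> real \<Rightarrow> (real \<Rightarrow> real) set" where
  "quasi_min_class a b \<omega> L K c \<delta>0 =
      {u \<in> W11 a b.
         {(x, u x) |x. x \<in> {a..b}} \<subseteq> K \<and>
         energy L u a b \<le> ereal c \<and>
         (\<forall>s\<in>{a..b}. \<forall>t\<in>{a..b}. s < t \<and> \<bar>s - t\<bar> \<le> \<delta>0 \<longrightarrow>
            energy L u a b
              \<le> energy L (affine_repl u s t) a b
                + ereal (\<omega> \<bar>slope u s t\<bar> \<bar>s - t\<bar> * \<bar>s - t\<bar>))}"

end

theory Submission
  imports Defs
begin

text \<open>
  The affine replacement \<open>w\<close> of a minimizer on \<open>[s,t]\<close> may leave the obstacles, but its truncation
  \<open>v = max f (min g w)\<close> is admissible, so it suffices to compare the energies of \<open>v\<close> and \<open>w\<close>.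
  They differ only where \<open>w < f\<close> or \<open>w > g\<close>, inside \<open>]s,t[\<close>. If \<open>w < f\<close> somewhere, then \<open>f - w\<close> has
  an interior maximum in \<open>]s,t[\<close>, so the slope \<open>k\<close> of \<open>w\<close> is a value of \<open>f'\<close>. Hence \<open>\<bar>k\<bar> \<le> M2\<close>, and the
  moduli of continuity bound both \<open>\<bar>f' - k\<bar>\<close> and \<open>\<bar>f - w\<bar>\<close>; the Hoelder condition then
  bounds the difference of the Lagrangians pointwise. The obstacle \<open>g\<close> is symmetric.
\<close>

section \<open>Closure properties of absolutely continuous functions\<close>

text \<open>On every sufficiently short family of intervals the increments of \<open>p\<close> and
  \<open>q\<close> each contribute less than \<open>e / 2\<close>. Sums, differences, maxima, minima
  and shifts by constants all satisfy the increment bound, so this one rule yields the closure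
  properties used below.\<close>

lemma W11_increment_le:
  assumes "p \<in> W11 a b" and "q \<in> W11 a b"
    and r: "\<And>x y. x \<in> {a..b} \<Longrightarrow> y \<in> {a..b} \<Longrightarrow> \<bar>r x - r y\<bar> \<le> \<bar>p x - p y\<bar> + \<bar>q x - q y\<bar>"
  shows "r \<in> W11 a b"
  unfolding W11_def
proof (intro CollectI allI impI)
  fix e :: real assume "e > 0"
  then have e2: "e / 2 > 0" by simp
  obtain d1 where "d1 > 0" and d1: "\<And>(n::nat) s t.
      (\<forall>i<n. a \<le> s i \<and> s i \<le> t i \<and> t i \<le> b) \<and>
      (\<forall>i<n. \<forall>j<n. i \<noteq> j \<longrightarrow> {s i<..<t i} \<inter> {s j<..<t j} = {}) \<and>
      (\<Sum>i<n. t i - s i) < d1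
      \<Longrightarrow> (\<Sum>i<n. \<bar>p (t i) - p (s i)\<bar>) < e / 2"
    using assms(1) e2 unfolding W11_def by blast
  obtain d2 where "d2 > 0" and d2: "\<And>(n::nat) s t.
      (\<forall>i<n. a \<le> s i \<and> s i \<le> t i \<and> t i \<le> b) \<and>
      (\<forall>i<n. \<forall>j<n. i \<noteq> j \<longrightarrow> {s i<..<t i} \<inter> {s j<..<t j} = {}) \<and>
      (\<Sum>i<n. t i - s i) < d2
      \<Longrightarrow> (\<Sum>i<n. \<bar>q (t i) - q (s i)\<bar>) < e / 2"
    using assms(2) e2 unfolding W11_def by blast
  show "\<exists>\<delta>>0. \<forall>(n::nat) s t.
      (\<forall>i<n. a \<le> s i \<and> s i \<le> t i \<and> t i \<le> b) \<and>
      (\<forall>i<n. \<forall>j<n. i \<noteq> j \<longrightarrow> {s i<..<t i} \<inter> {s j<..<t j} = {}) \<and>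
      (\<Sum>i<n. t i - s i) < \<delta>
      \<longrightarrow> (\<Sum>i<n. \<bar>r (t i) - r (s i)\<bar>) < e"
  proof (intro exI conjI allI impI)
    show "min d1 d2 > 0" using \<open>d1 > 0\<close> \<open>d2 > 0\<close> by simp
    fix n :: nat and s t
    assume *: "(\<forall>i<n. a \<le> s i \<and> s i \<le> t i \<and> t i \<le> b) \<and>
      (\<forall>i<n. \<forall>j<n. i \<noteq> j \<longrightarrow> {s i<..<t i} \<inter> {s j<..<t j} = {}) \<and>
      (\<Sum>i<n. t i - s i) < min d1 d2"
    have "(\<Sum>i<n. \<bar>r (t i) - r (s i)\<bar>) \<le> (\<Sum>i<n. \<bar>p (t i) - p (s i)\<bar> + \<bar>q (t i) - q (s i)\<bar>)"
      by (rule sum_mono, rule r) (use * in \<open>force+\<close>)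
    also have "\<dots> = (\<Sum>i<n. \<bar>p (t i) - p (s i)\<bar>) + (\<Sum>i<n. \<bar>q (t i) - q (s i)\<bar>)"
      by (rule sum.distrib)
    also have "\<dots> < e / 2 + e / 2"
      by (intro add_strict_mono d1 d2) (use * in auto)
    finally show "(\<Sum>i<n. \<bar>r (t i) - r (s i)\<bar>) < e" by simp
  qed
qed

lemma Lipschitz_W11:
  assumes lip: "\<And>x y. x \<in> {a..b} \<Longrightarrow> y \<in> {a..b} \<Longrightarrow> \<bar>p x - p y\<bar> \<le> M * \<bar>x - y\<bar>"
  shows "p \<in> W11 a b"
  unfolding W11_def
proof (intro CollectI allI impI)
  fix e :: real assume "e > 0"
  show "\<exists>\<delta>>0. \<forall>(n::nat) s t.
      (\<forall>i<n. a \<le> s i \<and> s i \<le> t i \<and> t i \<le> b) \<and>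
      (\<forall>i<n. \<forall>j<n. i \<noteq> j \<longrightarrow> {s i<..<t i} \<inter> {s j<..<t j} = {}) \<and>
      (\<Sum>i<n. t i - s i) < \<delta>
      \<longrightarrow> (\<Sum>i<n. \<bar>p (t i) - p (s i)\<bar>) < e"
  proof (intro exI conjI allI impI)
    \<comment> \<open>The absolute value and the added 1 keep the denominator positive for every
      \<open>M\<close>.\<close>
    show pos: "e / (\<bar>M\<bar> + 1) > 0" using \<open>e > 0\<close> by simp
    fix n :: nat and s t
    assume *: "(\<forall>i<n. a \<le> s i \<and> s i \<le> t i \<and> t i \<le> b) \<and>
      (\<forall>i<n. \<forall>j<n. i \<noteq> j \<longrightarrow> {s i<..<t i} \<inter> {s j<..<t j} = {}) \<and>
      (\<Sum>i<n. t i - s i) < e / (\<bar>M\<bar> + 1)"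
    have "\<bar>p (t i) - p (s i)\<bar> \<le> (\<bar>M\<bar> + 1) * (t i - s i)" if "i < n" for i
    proof -
      have st: "a \<le> s i" "s i \<le> t i" "t i \<le> b" using * that by auto
      have "\<bar>p (t i) - p (s i)\<bar> \<le> M * (t i - s i)" using lip[of "t i" "s i"] st by auto
      also have "\<dots> \<le> (\<bar>M\<bar> + 1) * (t i - s i)" by (rule mult_right_mono) (use st in auto)
      finally show ?thesis .
    qed
    then have "(\<Sum>i<n. \<bar>p (t i) - p (s i)\<bar>) \<le> (\<bar>M\<bar> + 1) * (\<Sum>i<n. t i - s i)"
      unfolding sum_distrib_left by (intro sum_mono) auto
    also have "\<dots> < e"
      using * pos by (simp add: pos_less_divide_eq mult.commute)
    finally show "(\<Sum>i<n. \<bar>p (t i) - p (s i)\<bar>) < e" .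
  qed
qed

text \<open>Clamping sends disjoint intervals to disjoint intervals that are no longer, so the
  \<delta> of \<open>u\<close> serves again. Intervals outside \<open>[s,t]\<close> collapse to
  points, which \<open>W11\<close> admits as degenerate members of a family.\<close>

lemma W11_clamp:
  assumes u: "u \<in> W11 a b" and st: "a \<le> s" "s \<le> t" "t \<le> b"
  shows "(\<lambda>x. u (max s (min t x))) \<in> W11 a b"
  unfolding W11_def
proof (intro CollectI allI impI)
  fix e :: real assume "e > 0"
  obtain d where "d > 0" and d: "\<And>(n::nat) p q.
      (\<forall>i<n. a \<le> p i \<and> p i \<le> q i \<and> q i \<le> b) \<and>
      (\<forall>i<n. \<forall>j<n. i \<noteq> j \<longrightarrow> {p i<..<q i} \<inter> {p j<..<q j} = {}) \<and>
      (\<Sum>i<n. q i - p i) < d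
      \<Longrightarrow> (\<Sum>i<n. \<bar>u (q i) - u (p i)\<bar>) < e"
    using u \<open>e > 0\<close> unfolding W11_def by blast
  let ?c = "\<lambda>x. max s (min t x)"
  show "\<exists>\<delta>>0. \<forall>(n::nat) p q.
      (\<forall>i<n. a \<le> p i \<and> p i \<le> q i \<and> q i \<le> b) \<and>
      (\<forall>i<n. \<forall>j<n. i \<noteq> j \<longrightarrow> {p i<..<q i} \<inter> {p j<..<q j} = {}) \<and>
      (\<Sum>i<n. q i - p i) < \<delta>
      \<longrightarrow> (\<Sum>i<n. \<bar>u (?c (q i)) - u (?c (p i))\<bar>) < e"
  proof (intro exI conjI allI impI)
    show "d > 0" by fact
    fix n :: nat and p q
    assume *: "(\<forall>i<n. a \<le> p i \<and> p i \<le> q i \<and> q i \<le> b) \<and>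
      (\<forall>i<n. \<forall>j<n. i \<noteq> j \<longrightarrow> {p i<..<q i} \<inter> {p j<..<q j} = {}) \<and>
      (\<Sum>i<n. q i - p i) < d"
    show "(\<Sum>i<n. \<bar>u (?c (q i)) - u (?c (p i))\<bar>) < e"
    proof (rule d, intro conjI allI impI)
      have sub: "{?c x<..<?c y} \<subseteq> {x<..<y}" for x y
        using st by (auto simp: max_def min_def split: if_splits)
      fix i j assume "i < n" "j < n" "i \<noteq> j"
      then have "{p i<..<q i} \<inter> {p j<..<q j} = {}" using * by auto
      then show "{?c (p i)<..<?c (q i)} \<inter> {?c (p j)<..<?c (q j)} = {}"
        using sub[of "p i" "q i"] sub[of "p j" "q j"] by blast
    next
      have "(\<Sum>i<n. ?c (q i) - ?c (p i)) \<le> (\<Sum>i<n. q i - p i)"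
        by (rule sum_mono) (use * in \<open>auto simp: max_def min_def\<close>)
      also have "\<dots> < d" using * by simp
      finally show "(\<Sum>i<n. ?c (q i) - ?c (p i)) < d" .
    qed (use * st in \<open>force simp: max_def min_def\<close>)+
  qed
qed

text \<open>Subtracting the clamped function removes the variation of \<open>u\<close> on
  \<open>[s,t]\<close>, and a ramp with the slope of the chord puts the increment
  \<open>u t - u s\<close> back. Both corrections are absolutely continuous.\<close>

lemma affine_repl_W11:
  assumes u: "u \<in> W11 a b" and st: "a \<le> s" "s < t" "t \<le> b"
  shows "affine_repl u s t \<in> W11 a b"
proof -
  let ?c = "\<lambda>x. max s (min t x)"
  let ?l = "\<lambda>x. slope u s t * ?c x"
  have l: "?l \<in> W11 a b"
  proof (rule Lipschitz_W11)
    fix x y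
    have "\<bar>?l x - ?l y\<bar> = \<bar>slope u s t\<bar> * \<bar>?c x - ?c y\<bar>"
      by (simp only: abs_mult[symmetric] right_diff_distrib)
    also have "\<dots> \<le> \<bar>slope u s t\<bar> * \<bar>x - y\<bar>"
      by (rule mult_left_mono) (auto simp: max_def min_def)
    finally show "\<bar>?l x - ?l y\<bar> \<le> \<bar>slope u s t\<bar> * \<bar>x - y\<bar>" .
  qed
  have "(\<lambda>x. u x - u (?c x)) \<in> W11 a b"
  proof (rule W11_increment_le[OF u])
    show "(\<lambda>x. u (?c x)) \<in> W11 a b"
      using u st by (intro W11_clamp) auto
  qed linarith
  then have W: "(\<lambda>x. u x - u (?c x) + ?l x) \<in> W11 a b"
    by (rule W11_increment_le[OF _ l]) linarith
  \<comment> \<open>The constant in the last summand makes both sides agree at \<open>s\<close>; to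
    the right of \<open>t\<close> they agree because the ramp rises by exactly
    \<open>u t - u s\<close>.\<close>
  have eq: "affine_repl u s t x = u x - u (?c x) + ?l x + (u s - slope u s t * s)" for x
  proof -
    define k where "k = slope u s t"
    have kt: "k * t = k * s + u t - u s"
      using st by (simp add: k_def slope_def field_simps)
    consider "x \<le> s" | "s < x \<and> x < t" | "t \<le> x" by linarith
    then show ?thesis
      using st by cases (simp_all add: affine_repl_def kt right_diff_distrib flip: k_def)
  qed
  show ?thesis
    \<comment> \<open>A constant does not change increments, so the zero function is the second
      dominating function.\<close>
    by (rule W11_increment_le[OF W Lipschitz_W11[of a b "\<lambda>x. 0" 0]]) (simp_all add: eq)
qed

section \<open>Sup norms, moduli of continuity and the data of the class\<close>

lemma C1_Lipschitz:
  fixes f f' :: "real \<Rightarrow> real"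
  assumes d: "\<And>x. x \<in> {a..b} \<Longrightarrow> (f has_real_derivative f' x) (at x within {a..b})"
    and M: "\<And>x. x \<in> {a..b} \<Longrightarrow> \<bar>f' x\<bar> \<le> M"
    and "x \<in> {a..b}" "y \<in> {a..b}"
  shows "\<bar>f x - f y\<bar> \<le> M * \<bar>x - y\<bar>"
  using field_differentiable_bound[of "{a..b}" f f' M x y] assms by auto

lemma abs_le_sup_norm:
  assumes "continuous_on {a..b} h" "x \<in> {a..b}"
  shows "\<bar>h x\<bar> \<le> sup_norm a b h"
  unfolding sup_norm_def
proof (rule cSUP_upper)
  show "bdd_above ((\<lambda>x. \<bar>h x\<bar>) ` {a..b})"
    using assms by (intro bounded_imp_bdd_above compact_imp_bounded compact_continuous_image)
      (auto intro!: continuous_intros)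
qed (use assms in auto)

lemma modulus_bdd_above:
  fixes h :: "real \<Rightarrow> real"
  assumes "continuous_on {a..b} h"
  shows "bdd_above {\<bar>h x - h y\<bar> |x y. x \<in> {a..b} \<and> y \<in> {a..b} \<and> \<bar>x - y\<bar> \<le> \<epsilon>}"
proof (rule bdd_aboveI)
  fix z assume "z \<in> {\<bar>h x - h y\<bar> |x y. x \<in> {a..b} \<and> y \<in> {a..b} \<and> \<bar>x - y\<bar> \<le> \<epsilon>}"
  then show "z \<le> 2 * sup_norm a b h"
    using abs_le_sup_norm[OF assms] by (smt (verit) mem_Collect_eq)
qed

lemma abs_diff_le_modulus:
  assumes "continuous_on {a..b} h" "x \<in> {a..b}" "y \<in> {a..b}" "\<bar>x - y\<bar> \<le> \<epsilon>"
  shows "\<bar>h x - h y\<bar> \<le> modulus a b h \<epsilon>"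
  unfolding modulus_def by (rule cSup_upper[OF _ modulus_bdd_above]) (use assms in auto)

lemma modulus_mono:
  assumes "continuous_on {a..b} h" "a \<le> b" "0 \<le> \<epsilon>" "\<epsilon> \<le> \<epsilon>'"
  shows "modulus a b h \<epsilon> \<le> modulus a b h \<epsilon>'"
  unfolding modulus_def
proof (rule cSup_subset_mono[OF _ modulus_bdd_above])
  show "{\<bar>h x - h y\<bar> |x y. x \<in> {a..b} \<and> y \<in> {a..b} \<and> \<bar>x - y\<bar> \<le> \<epsilon>} \<noteq> {}"
    using assms by (auto intro!: exI[of _ a])
qed (use assms in force)+

lemma modulus_zero:
  assumes "a \<le> b"
  shows "modulus a b h 0 = 0"
proof -
  have "{\<bar>h x - h y\<bar> |x y. x \<in> {a..b} \<and> y \<in> {a..b} \<and> \<bar>x - y\<bar> \<le> 0} = {0}"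
    using assms by (auto intro!: exI[of _ a])
  then show ?thesis by (simp add: modulus_def)
qed

lemma modulus_nonneg:
  assumes "continuous_on {a..b} h" "a \<le> b" "0 \<le> \<epsilon>"
  shows "0 \<le> modulus a b h \<epsilon>"
  using modulus_mono[OF assms(1,2) order_refl assms(3)] modulus_zero[OF assms(2)] by simp

lemma sup_norm_minus: "sup_norm a b (\<lambda>x. - h x) = sup_norm a b h"
  by (simp add: sup_norm_def)

lemma modulus_minus: "modulus a b (\<lambda>x. - h x) \<epsilon> = modulus a b h \<epsilon>"
proof -
  have "\<bar>- h x - - h y\<bar> = \<bar>h x - h y\<bar>" for x y by simp
  then show ?thesis by (simp only: modulus_def)
qed

lemma class_data_modulus:
  fixes f g f' g' :: "real \<Rightarrow> real"
  assumes "a \<le> b" and f: "continuous_on {a..b} f" and f': "continuous_on {a..b} f'"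
    and g: "continuous_on {a..b} g" and g': "continuous_on {a..b} g'"
    and "c > 0" "\<delta> > 0" "C > 0" "\<alpha> > 0"
  shows "class_data a b (\<lambda>k \<epsilon>. C * ((modulus a b f \<epsilon> + modulus a b f' \<epsilon> + k * \<epsilon>) powr \<alpha>
                         + (modulus a b g \<epsilon> + modulus a b g' \<epsilon> + k * \<epsilon>) powr \<alpha>))
      {(x, y). x \<in> {a..b} \<and> f x \<le> y \<and> y \<le> g x} c \<delta>"
proof -
  let ?K = "{(x, y). x \<in> {a..b} \<and> f x \<le> y \<and> y \<le> g x}"
  have "closed {p \<in> {a..b} \<times> UNIV. f (fst p) - snd p \<le> 0}"
    by (intro continuous_on_closed_Collect_le)
      (auto intro!: continuous_intros continuous_on_compose2[OF f] closed_Times)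
  moreover have "closed {p \<in> {a..b} \<times> UNIV. snd p - g (fst p) \<le> 0}"
    by (intro continuous_on_closed_Collect_le)
      (auto intro!: continuous_intros continuous_on_compose2[OF g] closed_Times)
  ultimately have "closed ({p \<in> {a..b} \<times> UNIV. f (fst p) - snd p \<le> 0} \<inter>
      {p \<in> {a..b} \<times> UNIV. snd p - g (fst p) \<le> 0})"
    by (rule closed_Int)
  also have "\<dots> = ?K" by auto
  finally have "closed ?K" .
  moreover have "?K \<subseteq> {a..b} \<times> {- sup_norm a b f..sup_norm a b g}"
    using abs_le_sup_norm[OF f] abs_le_sup_norm[OF g] by force
  then have "bounded ?K"
    by (rule bounded_subset[rotated]) (intro bounded_Times bounded_closed_interval)
  ultimately have "compact ?K" by (simp add: compact_eq_bounded_closed)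
  moreover have "C * ((modulus a b f \<epsilon> + modulus a b f' \<epsilon> + k * \<epsilon>) powr \<alpha>
        + (modulus a b g \<epsilon> + modulus a b g' \<epsilon> + k * \<epsilon>) powr \<alpha>)
      \<le> C * ((modulus a b f \<epsilon>' + modulus a b f' \<epsilon>' + k' * \<epsilon>') powr \<alpha>
        + (modulus a b g \<epsilon>' + modulus a b g' \<epsilon>' + k' * \<epsilon>') powr \<alpha>)"
    if "0 \<le> k" "k \<le> k'" "0 \<le> \<epsilon>" "\<epsilon> \<le> \<epsilon>'" for k k' \<epsilon> \<epsilon>'
    using assms that
    by (intro mult_left_mono add_mono powr_mono2 modulus_mono add_nonneg_nonneg modulus_nonneg mult_mono
        mult_nonneg_nonneg) auto
  \<comment> \<open>For \<epsilon> = 0 the moduli and \<open>k * \<epsilon>\<close> vanish, and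
    \<open>0 powr \<alpha> = 0\<close>.\<close>
  ultimately show ?thesis
    unfolding class_data_def using assms by (auto simp: modulus_zero)
qed

section \<open>Signed integrals of possibly non-measurable integrands\<close>

text \<open>The integral is a supremum over simple functions below the integrand, so additivity
  survives when only \<open>G\<close> is measurable. A simple \<open>h\<close> below
  \<open>F + G\<close> gives the measurable function \<open>h - G\<close> below \<open>F\<close>;
  conversely, a simple \<open>h\<close> below \<open>F\<close> gives \<open>h + G\<close> below
  \<open>F + G\<close>.\<close>

lemma nn_integral_add_measurable:
  assumes G: "G \<in> borel_measurable M" and fin: "\<And>x. G x < \<infinity>"
  shows "(\<integral>\<^sup>+x. F x + G x \<partial>M) = (\<integral>\<^sup>+x. F x \<partial>M) + (\<integral>\<^sup>+x. G x \<partial>M)"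
proof (rule antisym)
  show "(\<integral>\<^sup>+x. F x + G x \<partial>M) \<le> (\<integral>\<^sup>+x. F x \<partial>M) + (\<integral>\<^sup>+x. G x \<partial>M)"
    unfolding nn_integral_def[of M "\<lambda>x. F x + G x"]
  proof (rule SUP_least)
    fix h assume "h \<in> {h. simple_function M h \<and> h \<le> (\<lambda>x. F x + G x)}"
    then have h: "simple_function M h" and le: "\<And>x. h x \<le> F x + G x"
      by (auto simp: le_fun_def)
    have [measurable]: "h \<in> borel_measurable M" "G \<in> borel_measurable M"
      using h G by (auto intro: borel_measurable_simple_function)
    have "integral\<^sup>S M h = (\<integral>\<^sup>+x. h x \<partial>M)" using h by (simp add: nn_integral_eq_simple_integral)
    also have "\<dots> \<le> (\<integral>\<^sup>+x. (h x - G x) + G x \<partial>M)"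
      by (rule nn_integral_mono) (auto simp: diff_add_self_ennreal intro: less_imp_le)
    also have "\<dots> = (\<integral>\<^sup>+x. h x - G x \<partial>M) + (\<integral>\<^sup>+x. G x \<partial>M)"
      by (rule nn_integral_add) measurable
    also have "\<dots> \<le> (\<integral>\<^sup>+x. F x \<partial>M) + (\<integral>\<^sup>+x. G x \<partial>M)"
    proof (intro add_right_mono nn_integral_mono)
      fix x show "h x - G x \<le> F x"
        \<comment> \<open>Finiteness of \<open>G x\<close> excludes
          \<open>\<infinity> - \<infinity>\<close>, which is \<infinity> in \<open>ennreal\<close>
          and could exceed \<open>F x\<close>.\<close>
        using le[of x] fin[of x] by (auto simp: ennreal_minus_le_iff add.commute)
    qed
    finally show "integral\<^sup>S M h \<le> (\<integral>\<^sup>+x. F x \<partial>M) + (\<integral>\<^sup>+x. G x \<partial>M)" .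
  qed
  have ne: "{h. simple_function M h \<and> h \<le> F} \<noteq> {}"
    by (auto intro!: exI[of _ "\<lambda>x. 0"] simp: le_fun_def)
  show "(\<integral>\<^sup>+x. F x \<partial>M) + (\<integral>\<^sup>+x. G x \<partial>M) \<le> (\<integral>\<^sup>+x. F x + G x \<partial>M)"
    unfolding nn_integral_def[of M F] ennreal_SUP_add_left[OF ne, symmetric]
  proof (rule SUP_least)
    fix h assume "h \<in> {h. simple_function M h \<and> h \<le> F}"
    then have h: "simple_function M h" and le: "\<And>x. h x \<le> F x" by (auto simp: le_fun_def)
    have "integral\<^sup>S M h + (\<integral>\<^sup>+x. G x \<partial>M) = (\<integral>\<^sup>+x. h x \<partial>M) + (\<integral>\<^sup>+x. G x \<partial>M)"
      using h by (simp add: nn_integral_eq_simple_integral)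
    also have "\<dots> = (\<integral>\<^sup>+x. h x + G x \<partial>M)"
      using h G by (subst nn_integral_add) (auto intro: borel_measurable_simple_function)
    also have "\<dots> \<le> (\<integral>\<^sup>+x. F x + G x \<partial>M)"
      by (intro nn_integral_mono add_right_mono le)
    finally show "integral\<^sup>S M h + (\<integral>\<^sup>+x. G x \<partial>M) \<le> (\<integral>\<^sup>+x. F x + G x \<partial>M)" .
  qed
qed

text \<open>
  No measurability of \<open>p\<close> is assumed, since \<open>p\<close> is used with Lagrangians along functions that
  may fail to be differentiable; it only has to agree almost everywhere on \<open>S\<close> with an
  integrable \<open>P\<close>.
\<close>

lemma nn_integral_split:
  assumes P: "set_integrable M S P" and ae: "AE x in M. x \<in> S \<longrightarrow> p x = P x"
    and "S \<subseteq> A"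
  shows "(\<integral>\<^sup>+x\<in>A. ennreal (p x) \<partial>M)
      = (\<integral>\<^sup>+x\<in>A - S. ennreal (p x) \<partial>M) + (\<integral>\<^sup>+x. ennreal (indicator S x * P x) \<partial>M)"
proof -
  have [measurable]: "(\<lambda>x. indicator S x * P x) \<in> borel_measurable M"
    using P by (simp add: set_integrable_def borel_measurable_integrable)
  have "(\<integral>\<^sup>+x\<in>A. ennreal (p x) \<partial>M)
      = (\<integral>\<^sup>+x. ennreal (p x) * indicator (A - S) x + ennreal (indicator S x * P x) \<partial>M)"
    by (rule nn_integral_cong_AE) (use ae assms(3) in \<open>auto split: split_indicator\<close>)
  also have "\<dots> = (\<integral>\<^sup>+x\<in>A - S. ennreal (p x) \<partial>M) + (\<integral>\<^sup>+x. ennreal (indicator S x * P x) \<partial>M)"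
    by (rule nn_integral_add_measurable) auto
  finally show ?thesis .
qed

text \<open>Integrability on \<open>S\<close> makes the contribution of \<open>S\<close> to the
  positive and to the negative part finite, so it can be taken out as a real number even when the
  remainder over \<open>A - S\<close> is infinite or undefined.\<close>

lemma signed_nn_integral_split:
  assumes P: "set_integrable M S P" and ae: "AE x in M. x \<in> S \<longrightarrow> p x = P x"
    and "S \<subseteq> A"
  shows "enn2ereal (\<integral>\<^sup>+x\<in>A. ennreal (p x) \<partial>M) - enn2ereal (\<integral>\<^sup>+x\<in>A. ennreal (- p x) \<partial>M)
      = (enn2ereal (\<integral>\<^sup>+x\<in>A - S. ennreal (p x) \<partial>M) - enn2ereal (\<integral>\<^sup>+x\<in>A - S. ennreal (- p x) \<partial>M))
        + ereal (LINT x:S|M. P x)"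
proof -
  let ?Q = "\<lambda>x. indicator S x * P x"
  have Q: "integrable M ?Q" using P by (simp add: set_integrable_def)
  have P': "set_integrable M S (\<lambda>x. - P x)" using P by (simp add: set_integrable_def)
  define x where "x = (\<integral>\<^sup>+x\<in>A - S. ennreal (p x) \<partial>M)"
  define y where "y = (\<integral>\<^sup>+x\<in>A - S. ennreal (- p x) \<partial>M)"
  have fin: "(\<integral>\<^sup>+x. ennreal (?Q x) \<partial>M) \<noteq> \<infinity>" "(\<integral>\<^sup>+x. ennreal (- ?Q x) \<partial>M) \<noteq> \<infinity>"
    using Q by (auto simp: real_integrable_def)
  define q where "q = enn2real (\<integral>\<^sup>+x. ennreal (?Q x) \<partial>M)"
  define r where "r = enn2real (\<integral>\<^sup>+x. ennreal (- ?Q x) \<partial>M)"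
  have q: "(\<integral>\<^sup>+x. ennreal (?Q x) \<partial>M) = ennreal q" "q \<ge> 0"
    and r: "(\<integral>\<^sup>+x. ennreal (- ?Q x) \<partial>M) = ennreal r" "r \<ge> 0"
    using fin by (simp_all add: q_def r_def top.not_eq_extremum)
  have int: "(LINT x:S|M. P x) = q - r"
    using real_lebesgue_integral_def[OF Q] by (simp add: set_lebesgue_integral_def q_def r_def)
  have pos: "(\<integral>\<^sup>+x\<in>A. ennreal (p x) \<partial>M) = x + ennreal q"
    using nn_integral_split[OF assms] by (simp only: x_def q)
  have "AE x in M. x \<in> S \<longrightarrow> - p x = - P x" using ae by auto
  from nn_integral_split[OF P' this assms(3)]
  have neg: "(\<integral>\<^sup>+x\<in>A. ennreal (- p x) \<partial>M) = y + ennreal r"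
    by (simp only: y_def r mult_minus_right)
  \<comment> \<open>With the convention \<open>\<infinity> - \<infinity> = \<infinity>\<close> both
    sides are \<infinity> when the difference is undefined, so no case needs to be excluded.\<close>
  have "X + ereal q - (Y + ereal r) = (X - Y) + ereal (q - r)" for X Y
    by (cases X; cases Y) simp_all
  then show ?thesis
    unfolding pos neg int x_def[symmetric] y_def[symmetric]
    using q(2) r(2) by (simp only: plus_ennreal.rep_eq enn2ereal_ennreal)
qed

text \<open>Meant for the Lagrangians along two functions that differ only on \<open>S\<close>. The
  parts over \<open>A - S\<close> coincide as extended reals, whatever their values, and on
  \<open>S\<close> it remains to compare two real integrals.\<close>

lemma signed_nn_integral_mono:
  fixes p q :: "'a \<Rightarrow> real"
  assumes S: "S \<in> sets M" "S \<subseteq> A" "emeasure M S < \<infinity>"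
    and P: "set_integrable M S P" and p: "AE x in M. x \<in> S \<longrightarrow> p x = P x"
    and Q: "set_integrable M S Q" and q: "AE x in M. x \<in> S \<longrightarrow> q x = Q x"
    and out: "AE x in M. x \<in> A - S \<longrightarrow> p x = q x"
    and le: "\<And>x. x \<in> S \<Longrightarrow> P x \<le> Q x + d"
  shows "enn2ereal (\<integral>\<^sup>+x\<in>A. ennreal (p x) \<partial>M) - enn2ereal (\<integral>\<^sup>+x\<in>A. ennreal (- p x) \<partial>M)
      \<le> (enn2ereal (\<integral>\<^sup>+x\<in>A. ennreal (q x) \<partial>M) - enn2ereal (\<integral>\<^sup>+x\<in>A. ennreal (- q x) \<partial>M))
        + ereal (d * measure M S)"
proof -
  have d: "set_integrable M S (\<lambda>x. d)"
    unfolding set_integrable_def using S by simp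
  have "(LINT x:S|M. P x) \<le> (LINT x:S|M. Q x + d)"
    by (rule set_integral_mono[OF P]) (use Q d le in \<open>auto intro: set_integral_add\<close>)
  also have "\<dots> = (LINT x:S|M. Q x) + d * measure M S"
    using set_integral_add(2)[OF Q d] S by (simp add: set_integral_const)
  finally have I: "(LINT x:S|M. P x) \<le> (LINT x:S|M. Q x) + d * measure M S" .
  have "(\<integral>\<^sup>+x\<in>A - S. ennreal (p x) \<partial>M) = (\<integral>\<^sup>+x\<in>A - S. ennreal (q x) \<partial>M)"
    "(\<integral>\<^sup>+x\<in>A - S. ennreal (- p x) \<partial>M) = (\<integral>\<^sup>+x\<in>A - S. ennreal (- q x) \<partial>M)"
    by (rule nn_integral_cong_AE, use out in \<open>auto split: split_indicator\<close>)+
  then show ?thesis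
    unfolding signed_nn_integral_split[OF P p S(2)] signed_nn_integral_split[OF Q q S(2)]
    using I by (simp add: add.assoc add_left_mono)
qed

section \<open>Chords that cross an obstacle: derivatives of the truncation and bounds for the
  chord\<close>

text \<open>Each isolated point of \<open>S\<close> is cut out of \<open>S\<close> by a member of a
  countable basis, and different points need different members.\<close>

lemma countable_isolated_points:
  fixes S :: "'a :: second_countable_topology set"
  assumes "\<And>x. x \<in> T \<Longrightarrow> x \<in> S \<and> \<not> x islimpt S"
  shows "countable T"
proof -
  obtain B :: "'a set set" where B: "countable B" "topological_basis B"
    using ex_countable_basis by blast
  have "\<exists>U\<in>B. U \<inter> S = {x}" if "x \<in> T" for x
  proof -
    have x: "x \<in> S" "\<not> x islimpt S" using assms[OF that] by auto
    then obtain V where V: "x \<in> V" "open V" "\<And>y. y \<in> S \<Longrightarrow> y \<in> V \<Longrightarrow> y = x"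
      unfolding islimpt_def by blast
    obtain U where "U \<in> B" "x \<in> U" "U \<subseteq> V"
      using topological_basisE[OF B(2) V(2,1)] .
    with V(3) x(1) show ?thesis by blast
  qed
  then obtain U where U: "\<And>x. x \<in> T \<Longrightarrow> U x \<in> B \<and> U x \<inter> S = {x}" by metis
  then have "inj_on U T" by (metis inj_onI singleton_inject)
  moreover have "countable (U ` T)" using U B(1) by (metis countable_subset image_subsetI)
  ultimately show ?thesis by (rule countable_image_inj_on[rotated])
qed

text \<open>The difference quotients at \<open>x\<close> tend to \<open>D \<noteq> 0\<close>,
  whereas at any further zero the quotient would be 0.\<close>

lemma zero_not_islimpt:
  fixes \<phi> :: "real \<Rightarrow> real"
  assumes "(\<phi> has_real_derivative D) (at x)" "D \<noteq> 0" "\<phi> x = 0"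
  shows "\<not> x islimpt {y. \<phi> y = 0}"
proof -
  have "((\<lambda>y. (\<phi> y - \<phi> x) / (y - x)) \<longlongrightarrow> D) (at x)"
    using assms(1) by (simp add: has_field_derivative_iff)
  then have "\<forall>\<^sub>F y in at x. (\<phi> y - \<phi> x) / (y - x) \<noteq> 0"
    using assms(2) by (rule tendsto_imp_eventually_ne)
  then have "\<forall>\<^sub>F y in at x. \<phi> y \<noteq> 0"
    by eventually_elim (use assms(3) in auto)
  then show ?thesis
    by (simp add: islimpt_iff_eventually)
qed

text \<open>Each difference quotient of \<open>v\<close> at \<open>x\<close> is one of
  \<open>h\<close> or of \<open>k\<close>, and both families tend to \<open>D\<close>, however
  \<open>v\<close> switches between the two. This handles contact points of a line with an obstacle;
  taking \<open>h = k\<close> handles points where \<open>v\<close> is locally a single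
  function.\<close>

lemma has_real_derivative_pieces:
  fixes v h k :: "real \<Rightarrow> real"
  assumes h: "(h has_real_derivative D) (at x)" and k: "(k has_real_derivative D) (at x)"
    and x: "h x = v x" "k x = v x"
    and ev: "\<forall>\<^sub>F y in nhds x. v y = h y \<or> v y = k y"
  shows "(v has_real_derivative D) (at x)"
  unfolding has_field_derivative_iff
proof (rule tendstoI)
  fix e :: real assume "e > 0"
  have "((\<lambda>y. (h y - v x) / (y - x)) \<longlongrightarrow> D) (at x)" "((\<lambda>y. (k y - v x) / (y - x)) \<longlongrightarrow> D) (at x)"
    using h k x by (simp_all add: has_field_derivative_iff)
  then have "\<forall>\<^sub>F y in at x. dist ((h y - v x) / (y - x)) D < e"
    "\<forall>\<^sub>F y in at x. dist ((k y - v x) / (y - x)) D < e"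
    using \<open>e > 0\<close> by (blast dest: tendstoD)+
  moreover have "\<forall>\<^sub>F y in at x. v y = h y \<or> v y = k y"
    using ev by (simp add: eventually_at_filter eventually_mono)
  ultimately show "\<forall>\<^sub>F y in at x. dist ((v y - v x) / (y - x)) D < e"
    by eventually_elim auto
qed

text \<open>The excess of \<open>f\<close> over the chord is nonpositive at \<open>s\<close> and
  \<open>t\<close> but positive at \<open>x\<close>, so its maximum over \<open>[s,t]\<close> is
  attained inside, where its derivative vanishes. The bound on the excess comes from the left end:
  \<open>f s \<le> y\<close> lets \<open>f s\<close> replace \<open>y\<close>.\<close>

lemma chord_below:
  fixes f f' :: "real \<Rightarrow> real"
  assumes d: "\<And>x. x \<in> {s..t} \<Longrightarrow> (f has_real_derivative f' x) (at x within {s..t})"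
    and x: "x \<in> {s<..<t}"
    and ends: "f s \<le> y" "f t \<le> y + k * (t - s)"
    and below: "y + k * (x - s) < f x"
  obtains \<xi> where "\<xi> \<in> {s<..<t}" "f' \<xi> = k" "f x - (y + k * (x - s)) \<le> \<bar>f x - f s\<bar> + \<bar>k\<bar> * (x - s)"
proof -
  define \<phi> where "\<phi> = (\<lambda>z. f z - (y + k * (z - s)))"
  have d\<phi>: "(\<phi> has_real_derivative f' z - k) (at z within {s..t})" if "z \<in> {s..t}" for z
    unfolding \<phi>_def by (rule derivative_eq_intros d[OF that] refl | simp)+
  then have "continuous_on {s..t} \<phi>"
    by (rule DERIV_continuous_on)
  then obtain \<xi> where \<xi>: "\<xi> \<in> {s..t}" "\<And>z. z \<in> {s..t} \<Longrightarrow> \<phi> z \<le> \<phi> \<xi>"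
    using continuous_attains_sup[of "{s..t}" \<phi>] x by auto
  have "\<phi> x \<le> \<phi> \<xi>" using \<xi>(2) x by auto
  moreover have "\<phi> s \<le> 0" "\<phi> t \<le> 0" "\<phi> x > 0" using ends below by (auto simp: \<phi>_def)
  ultimately have "\<xi> \<noteq> s" "\<xi> \<noteq> t" by auto
  then have \<xi>': "\<xi> \<in> {s<..<t}" using \<xi> by auto
  then have "(\<phi> has_real_derivative f' \<xi> - k) (at \<xi>)"
    using d\<phi>[OF \<xi>(1)] by (simp add: at_within_Icc_at)
  moreover have "\<forall>z. \<bar>\<xi> - z\<bar> < min (\<xi> - s) (t - \<xi>) \<longrightarrow> \<phi> z \<le> \<phi> \<xi>"
    by (intro allI impI \<xi>(2)) auto
  ultimately have "f' \<xi> - k = 0"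
    using \<xi>' by (intro DERIV_local_max[of \<phi> _ \<xi> "min (\<xi> - s) (t - \<xi>)"]) auto
  moreover have "- k * (x - s) \<le> \<bar>k\<bar> * (x - s)"
    using x by (intro mult_right_mono) auto
  then have "f x - (y + k * (x - s)) \<le> \<bar>f x - f s\<bar> + \<bar>k\<bar> * (x - s)"
    using ends(1) by linarith
  ultimately show thesis
    using that[OF \<xi>'] by simp
qed

lemma eventually_nhds_less:
  fixes p q :: "real \<Rightarrow> real"
  assumes "isCont p x" "isCont q x" "p x < q x"
  shows "\<forall>\<^sub>F y in nhds x. p y < q y"
proof -
  have "((\<lambda>y. q y - p y) \<longlongrightarrow> q x - p x) (nhds x)"
    using assms(1,2) by (intro tendsto_diff) (simp_all add: isCont_def tendsto_at_iff_tendsto_nhds)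
  from order_tendstoD(1)[OF this, of 0] show ?thesis
    using assms(3) by (auto elim: eventually_mono)
qed

text \<open>
  At a zero of \<open>f - l\<close> where \<open>f'\<close> equals the slope the truncation has this slope too; the
  other zeros are isolated, hence countably many. The same holds for \<open>g\<close>.
\<close>

lemma truncated_line_derivative:
  fixes f g f' g' l :: "real \<Rightarrow> real"
  assumes f: "\<And>x. x \<in> S \<Longrightarrow> (f has_real_derivative f' x) (at x)"
    and g: "\<And>x. x \<in> S \<Longrightarrow> (g has_real_derivative g' x) (at x)"
    and l: "\<And>x. x \<in> S \<Longrightarrow> (l has_real_derivative k) (at x)"
    and less: "\<And>x. x \<in> S \<Longrightarrow> f x < g x"
  shows "countable {x \<in> S. \<not> ((\<lambda>y. max (f y) (min (g y) (l y))) has_real_derivative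
      (if l x < f x then f' x else if g x < l x then g' x else k)) (at x)}"
proof -
  let ?v = "\<lambda>y. max (f y) (min (g y) (l y))"
  define T where "T = (\<lambda>p p'. {x \<in> S. p x - l x = 0 \<and> p' x - k \<noteq> (0::real)})"
  have T: "countable (T p p')" if "\<And>x. x \<in> S \<Longrightarrow> (p has_real_derivative p' x) (at x)" for p p'
  proof (rule countable_isolated_points)
    fix x assume "x \<in> T p p'"
    then have x: "x \<in> S" "p x - l x = 0" "p' x - k \<noteq> 0" by (auto simp: T_def)
    then have "((\<lambda>x. p x - l x) has_real_derivative p' x - k) (at x)"
      using that l by (auto intro: DERIV_diff)
    from zero_not_islimpt[OF this x(3,2)] x(2)
    show "x \<in> {y. p y - l y = 0} \<and> \<not> x islimpt {y. p y - l y = 0}"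
      by auto
  qed
  have "(?v has_real_derivative (if l x < f x then f' x else if g x < l x then g' x else k)) (at x)"
    if x: "x \<in> S" "x \<notin> T f f'" "x \<notin> T g g'" for x
  proof -
    note df = f[OF x(1)] and dg = g[OF x(1)] and dl = l[OF x(1)]
    note cf = DERIV_isCont[OF df] and cg = DERIV_isCont[OF dg] and cl = DERIV_isCont[OF dl]
    \<comment> \<open>Near \<open>x\<close> the obstacles stay apart, so wherever the line reaches
      or passes \<open>g\<close> the outer maximum with \<open>f\<close> has no effect.\<close>
    have fg: "\<forall>\<^sub>F y in nhds x. f y < g y"
      using eventually_nhds_less[OF cf cg less[OF x(1)]] .
    have eq: "l x = f x \<Longrightarrow> f' x = k" "l x = g x \<Longrightarrow> g' x = k"
      using x by (auto simp: T_def)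
    consider "l x < f x" | "g x < l x" | "l x = f x" "f' x = k" | "l x = g x" "g' x = k"
      | "f x < l x" "l x < g x"
      using eq by (metis linorder_less_linear)
    then show ?thesis
    proof cases
      case 1
      have "(?v has_real_derivative f' x) (at x)"
      proof (rule has_real_derivative_pieces[OF df df])
        show "\<forall>\<^sub>F y in nhds x. ?v y = f y \<or> ?v y = f y"
          using eventually_nhds_less[OF cl cf 1] by eventually_elim auto
      qed (use 1 in auto)
      with 1 show ?thesis by simp
    next
      case 2
      have "(?v has_real_derivative g' x) (at x)"
      proof (rule has_real_derivative_pieces[OF dg dg])
        show "\<forall>\<^sub>F y in nhds x. ?v y = g y \<or> ?v y = g y"
          using fg eventually_nhds_less[OF cg cl 2] by eventually_elim auto
      qed (use 2 less[OF x(1)] in auto)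
      with 2 less[OF x(1)] show ?thesis by simp
    next
      case 3
      have "(?v has_real_derivative k) (at x)"
      proof (rule has_real_derivative_pieces[OF df[unfolded 3] dl])
        have "l x < g x" using less[OF x(1)] 3 by simp
        from eventually_nhds_less[OF cl cg this]
        show "\<forall>\<^sub>F y in nhds x. ?v y = f y \<or> ?v y = l y"
          by eventually_elim auto
      qed (use 3 less[OF x(1)] in auto)
      with 3 less[OF x(1)] show ?thesis by simp
    next
      case 4
      have "(?v has_real_derivative k) (at x)"
      proof (rule has_real_derivative_pieces[OF dg[unfolded 4] dl])
        have "f x < l x" using less[OF x(1)] 4 by simp
        from eventually_nhds_less[OF cf cl this] fg
        show "\<forall>\<^sub>F y in nhds x. ?v y = g y \<or> ?v y = l y"
          by eventually_elim auto
      qed (use 4 less[OF x(1)] in auto)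
      with 4 less[OF x(1)] show ?thesis by simp
    next
      case 5
      have "(?v has_real_derivative k) (at x)"
      proof (rule has_real_derivative_pieces[OF dl dl])
        from eventually_nhds_less[OF cf cl 5(1)] eventually_nhds_less[OF cl cg 5(2)]
        show "\<forall>\<^sub>F y in nhds x. ?v y = l y \<or> ?v y = l y"
          by eventually_elim auto
      qed (use 5 in auto)
      with 5 show ?thesis by simp
    qed
  qed
  then show ?thesis
    by (intro countable_subset[OF _ countable_Un[OF T[OF f] T[OF g]]]) blast
qed

lemma chord_below_bounds:
  fixes f f' :: "real \<Rightarrow> real"
  assumes d: "\<And>x. x \<in> {a..b} \<Longrightarrow> (f has_real_derivative f' x) (at x within {a..b})"
    and cont: "continuous_on {a..b} f'"
    and st: "a \<le> s" "s < t" "t \<le> b" and x: "x \<in> {s<..<t}"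
    and ends: "f s \<le> y" "f t \<le> y + k * (t - s)"
    and below: "y + k * (x - s) < f x"
  shows "\<bar>f x - (y + k * (x - s))\<bar> + \<bar>f' x - k\<bar>
        \<le> modulus a b f (t - s) + modulus a b f' (t - s) + \<bar>k\<bar> * (t - s)"
    and "\<bar>k\<bar> \<le> sup_norm a b f'"
    and "\<bar>y + k * (x - s)\<bar> \<le> sup_norm a b f + sup_norm a b f' * (b - a)"
proof -
  have contf: "continuous_on {a..b} f"
    using d by (rule DERIV_continuous_on)
  have "(f has_real_derivative f' z) (at z within {s..t})" if "z \<in> {s..t}" for z
    by (rule DERIV_subset[OF d]) (use that st in auto)
  then obtain \<xi> where \<xi>: "\<xi> \<in> {s<..<t}" "f' \<xi> = k"
      "f x - (y + k * (x - s)) \<le> \<bar>f x - f s\<bar> + \<bar>k\<bar> * (x - s)"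
    using chord_below[OF _ x ends below] by metis
  have "\<bar>f x - f s\<bar> \<le> modulus a b f (t - s)"
    by (rule abs_diff_le_modulus[OF contf]) (use st x in auto)
  \<comment> \<open>The slope is the value of \<open>f'\<close> at \<xi>, and both \<xi> and
    \<open>x\<close> lie in \<open>]s,t[\<close>.\<close>
  moreover have "\<bar>f' x - k\<bar> \<le> modulus a b f' (t - s)"
    unfolding \<xi>(2)[symmetric] by (rule abs_diff_le_modulus[OF cont]) (use st x \<xi>(1) in auto)
  moreover have "\<bar>k\<bar> * (x - s) \<le> \<bar>k\<bar> * (t - s)"
    by (rule mult_left_mono) (use x in auto)
  ultimately show "\<bar>f x - (y + k * (x - s))\<bar> + \<bar>f' x - k\<bar>
        \<le> modulus a b f (t - s) + modulus a b f' (t - s) + \<bar>k\<bar> * (t - s)"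
    using \<xi>(3) below by linarith
  show k: "\<bar>k\<bar> \<le> sup_norm a b f'"
    unfolding \<xi>(2)[symmetric] by (rule abs_le_sup_norm[OF cont]) (use st \<xi>(1) in auto)
  have "\<bar>k * (x - s)\<bar> \<le> sup_norm a b f' * (b - a)"
    unfolding abs_mult by (rule mult_mono[OF k]) (use st x k in auto)
  moreover have "\<bar>f s\<bar> \<le> sup_norm a b f" "\<bar>f x\<bar> \<le> sup_norm a b f"
    using abs_le_sup_norm[OF contf] st x by auto
  moreover have "0 \<le> sup_norm a b f' * (b - a)"
    by (rule mult_nonneg_nonneg) (use k st in auto)
  \<comment> \<open>At \<open>x\<close> the chord lies below \<open>f x\<close>; it also starts at
    or above \<open>f s\<close> and can descend by at most \<open>\<bar>k\<bar> * (b - a)\<close>.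
    This is the source of the summand \<open>M2 * (b - a)\<close> in \<open>M1\<close>.\<close>
  ultimately show "\<bar>y + k * (x - s)\<bar> \<le> sup_norm a b f + sup_norm a b f' * (b - a)"
    using ends(1) below by linarith
qed

lemma chord_above_bounds:
  fixes g g' :: "real \<Rightarrow> real"
  assumes d: "\<And>x. x \<in> {a..b} \<Longrightarrow> (g has_real_derivative g' x) (at x within {a..b})"
    and cont: "continuous_on {a..b} g'"
    and st: "a \<le> s" "s < t" "t \<le> b" and x: "x \<in> {s<..<t}"
    and ends: "y \<le> g s" "y + k * (t - s) \<le> g t"
    and above: "g x < y + k * (x - s)"
  shows "\<bar>g x - (y + k * (x - s))\<bar> + \<bar>g' x - k\<bar>
        \<le> modulus a b g (t - s) + modulus a b g' (t - s) + \<bar>k\<bar> * (t - s)"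
    and "\<bar>k\<bar> \<le> sup_norm a b g'"
    and "\<bar>y + k * (x - s)\<bar> \<le> sup_norm a b g + sup_norm a b g' * (b - a)"
proof -
  have "((\<lambda>x. - g x) has_real_derivative - g' x) (at x within {a..b})" if "x \<in> {a..b}" for x
    using d[OF that] by (rule DERIV_minus)
  \<comment> \<open>Reflection in the horizontal axis turns the upper obstacle into a lower one; sup
    norms and moduli do not change.\<close>
  from chord_below_bounds[of a b "\<lambda>x. - g x" "\<lambda>x. - g' x" s t x "- y" "- k", OF this _ st x]
  show "\<bar>g x - (y + k * (x - s))\<bar> + \<bar>g' x - k\<bar>
        \<le> modulus a b g (t - s) + modulus a b g' (t - s) + \<bar>k\<bar> * (t - s)"
    and "\<bar>k\<bar> \<le> sup_norm a b g'"
    and "\<bar>y + k * (x - s)\<bar> \<le> sup_norm a b g + sup_norm a b g' * (b - a)"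
    using ends above cont
    by (simp_all add: sup_norm_minus modulus_minus continuous_on_minus abs_minus_commute)
qed

section \<open>Energy of the truncated affine replacement\<close>

lemma set_integrable_if:
  fixes P Q :: "'a \<Rightarrow> real"
  assumes "set_integrable M S P" "set_integrable M S Q"
    and T: "S \<inter> {x. \<phi> x} \<in> sets M" "S \<in> sets M"
  shows "set_integrable M S (\<lambda>x. if \<phi> x then P x else Q x)"
proof -
  let ?R = "\<lambda>x. if \<phi> x then P x else Q x"
  have "set_integrable M (S \<inter> {x. \<phi> x}) P" "set_integrable M (S - S \<inter> {x. \<phi> x}) Q"
    using assms by (auto intro: set_integrable_subset)
  moreover have "set_integrable M (S \<inter> {x. \<phi> x}) ?R = set_integrable M (S \<inter> {x. \<phi> x}) P"
    "set_integrable M (S - S \<inter> {x. \<phi> x}) ?R = set_integrable M (S - S \<inter> {x. \<phi> x}) Q"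
    by (intro set_integrable_cong; auto)+
  ultimately have "set_integrable M (S \<inter> {x. \<phi> x} \<union> (S - S \<inter> {x. \<phi> x})) ?R"
    using T by (intro set_integrable_Un) auto
  then show ?thesis by (simp add: Int_Un_distrib Un_absorb2)
qed

text \<open>On \<open>]s,t[\<close> both Lagrangians agree almost everywhere with explicit
  integrable functions whose difference is at most \<open>d\<close>; on the rest of
  \<open>[a,b]\<close> they agree with each other almost everywhere. The energies themselves may be
  infinite.\<close>

lemma energy_truncation_le:
  fixes f g f' g' u :: "real \<Rightarrow> real" and L :: "real \<times> real \<times> real \<Rightarrow> real"
  assumes L: "continuous_on ({a..b} \<times> UNIV \<times> UNIV) L"
    and f: "\<And>x. x \<in> {a..b} \<Longrightarrow> (f has_real_derivative f' x) (at x within {a..b})"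
    and f': "continuous_on {a..b} f'"
    and g: "\<And>x. x \<in> {a..b} \<Longrightarrow> (g has_real_derivative g' x) (at x within {a..b})"
    and g': "continuous_on {a..b} g'"
    and less: "\<And>x. x \<in> {a..b} \<Longrightarrow> f x < g x"
    and u: "\<And>x. x \<in> {a..b} \<Longrightarrow> f x \<le> u x \<and> u x \<le> g x"
    and st: "a \<le> s" "s < t" "t \<le> b"
    and M2: "M2 = max (sup_norm a b f') (sup_norm a b g')"
    and M1: "M1 = max (sup_norm a b f) (sup_norm a b g) + M2 * (b - a)"
    and "C > 0" "\<alpha> > 0"
    and holder: "holder_on ({a..b} \<times> {-M1..M1} \<times> {-M2..M2}) L C \<alpha>"
    and k: "k = slope u s t"
    and d: "d = C * ((modulus a b f (t - s) + modulus a b f' (t - s) + \<bar>k\<bar> * (t - s)) powr \<alpha>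
                   + (modulus a b g (t - s) + modulus a b g' (t - s) + \<bar>k\<bar> * (t - s)) powr \<alpha>)"
  shows "energy L (\<lambda>x. max (f x) (min (g x) (affine_repl u s t x))) a b
      \<le> energy L (affine_repl u s t) a b + ereal (d * (t - s))"
proof -
  let ?S = "{s<..<t}"
  define w where "w = affine_repl u s t"
  define v where "v = (\<lambda>x. max (f x) (min (g x) (w x)))"
  define l where "l = (\<lambda>x. u s + k * (x - s))"
  define h where "h = (\<lambda>x. if l x < f x then f' x else if g x < l x then g' x else k)"
  \<comment> \<open>\<open>P\<close> is the Lagrangian along \<open>v\<close> with the almost
    everywhere derivative \<open>h\<close> inserted, written as three continuous pieces so that its
    integrability can be checked piece by piece.\<close>
  define P where "P = (\<lambda>x. if l x < f x then L (x, f x, f' x) else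
      if g x < l x then L (x, g x, g' x) else L (x, l x, k))"
  have sub: "?S \<subseteq> {a..b}" using st by auto
  have cf: "continuous_on {a..b} f" and cg: "continuous_on {a..b} g"
    by (rule DERIV_continuous_on, erule f g)+
  have cl: "continuous_on A l" for A unfolding l_def by (intro continuous_intros)
  have lt: "u s + k * (t - s) = u t"
    using st by (simp add: k slope_def field_simps)
  have w: "w x = l x" if "x \<in> ?S" for x
    using that by (simp add: w_def affine_repl_def l_def k)
  have P: "P x = L (x, v x, h x)" if "x \<in> ?S" for x
    using less[of x] that sub w[OF that] by (force simp: P_def h_def v_def)
  have dl: "(l has_real_derivative k) (at x)" for x
    unfolding l_def by (auto intro!: derivative_eq_intros)
  have at: "at x within {a..b} = at x" if "x \<in> ?S" for x
    using that st by (intro at_within_Icc_at) auto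
  have dw: "(w has_real_derivative k) (at x)" if "x \<in> ?S" for x
    by (rule has_field_derivative_transform_within_open[OF dl, where S = ?S]) (use that w in auto)

  have Lint: "set_integrable lebesgue ?S (\<lambda>x. L (x, p x, p' x))"
    if "continuous_on {a..b} p" "continuous_on {a..b} p'" for p p'
    by (rule set_integrable_subset[OF absolutely_integrable_continuous_real[of a b]])
      (use sub in \<open>auto intro!: continuous_on_compose2[OF L] continuous_intros that\<close>)
  \<comment> \<open>The sets on which \<open>P\<close> switches between its pieces are complements
    in \<open>]s,t[\<close> of closed sets, hence measurable.\<close>
  have "closed {x \<in> {a..b}. f x \<le> l x}" "closed {x \<in> {a..b}. l x \<le> g x}"
    by (intro continuous_on_closed_Collect_le cf cg cl closed_atLeastAtMost)+
  then have "?S - {x \<in> {a..b}. f x \<le> l x} \<in> sets lebesgue"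
      "?S - {x \<in> {a..b}. l x \<le> g x} \<in> sets lebesgue"
    by (auto intro!: sets.Diff)
  moreover have "?S - {x \<in> {a..b}. f x \<le> l x} = ?S \<inter> {x. l x < f x}"
      "?S - {x \<in> {a..b}. l x \<le> g x} = ?S \<inter> {x. g x < l x}"
    using sub by auto
  ultimately have meas: "?S \<inter> {x. l x < f x} \<in> sets lebesgue" "?S \<inter> {x. g x < l x} \<in> sets lebesgue"
    by simp_all
  have Pint: "set_integrable lebesgue ?S P"
    unfolding P_def using meas
    by (intro set_integrable_if Lint cf cg cl f' g') auto

  have "AE x in lebesgue. x \<notin> {x \<in> ?S. \<not> ((\<lambda>y. max (f y) (min (g y) (l y)))
      has_real_derivative h x) (at x)}"
    unfolding h_def
    by (intro AE_not_in null_sets_completionI countable_imp_null_set_lborel truncated_line_derivative dl less)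
      (use f g at sub in \<open>metis subsetD\<close>)+
  then have AEv: "AE x in lebesgue. x \<in> ?S \<longrightarrow> lagrangian_along L v a b x = P x"
  proof (rule AE_mp, intro AE_I2 impI)
    fix x assume x: "x \<in> ?S"
      and "x \<notin> {x \<in> ?S. \<not> ((\<lambda>y. max (f y) (min (g y) (l y))) has_real_derivative h x) (at x)}"
    then have "((\<lambda>y. max (f y) (min (g y) (l y))) has_real_derivative h x) (at x)" by blast
    then have "(v has_real_derivative h x) (at x)"
      by (rule has_field_derivative_transform_within_open[where S = ?S])
        (use x w in \<open>auto simp: v_def\<close>)
    then show "lagrangian_along L v a b x = P x"
      using vector_derivative_at[of v "h x" x]
      by (simp add: lagrangian_along_def at[OF x] P[OF x] has_real_derivative_iff_has_vector_derivative)
  qed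
  have AEw: "AE x in lebesgue. x \<in> ?S \<longrightarrow> lagrangian_along L w a b x = L (x, l x, k)"
  proof (intro AE_I2 impI)
    fix x assume x: "x \<in> ?S"
    show "lagrangian_along L w a b x = L (x, l x, k)"
      using vector_derivative_at[of w k x] dw[OF x]
      by (simp add: lagrangian_along_def at[OF x] w[OF x] has_real_derivative_iff_has_vector_derivative)
  qed

  have vw: "v x = w x" if "x \<in> {a..b} - ?S" for x
    using that u[of x] by (auto simp: v_def w_def affine_repl_def)
  \<comment> \<open>At \<open>s\<close> and \<open>t\<close> the derivatives of \<open>v\<close> and
    \<open>w\<close> may differ. At any other point outside \<open>]s,t[\<close> the two functions
    coincide nearby within \<open>[a,b]\<close>, so the values of \<open>vector_derivative\<close>
    agree even where no derivative exists.\<close>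
  have "AE x in lebesgue. x \<notin> {s, t}"
    by (intro AE_not_in null_sets_completionI countable_imp_null_set_lborel) auto
  then have out: "AE x in lebesgue. x \<in> {a..b} - ?S \<longrightarrow> lagrangian_along L v a b x = lagrangian_along L w a b x"
  proof (rule AE_mp, intro AE_I2 impI)
    fix x assume x: "x \<notin> {s, t}" "x \<in> {a..b} - ?S"
    then have "x \<in> - {s..t}" by auto
    then have "\<forall>\<^sub>F y in nhds x. y \<in> - {s..t}" by (intro eventually_nhds_in_open) auto
    then have "\<forall>\<^sub>F y in nhds x. y \<in> {a..b} \<longrightarrow> v y = w y"
      by eventually_elim (use vw in auto)
    then have "vector_derivative v (at x within {a..b}) = vector_derivative w (at x within {a..b})"
      by (rule vector_derivative_cong_eq) (use x in auto)
    then show "lagrangian_along L v a b x = lagrangian_along L w a b x"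
      using vw x by (simp add: lagrangian_along_def)
  qed

  have le: "P x \<le> L (x, l x, k) + d" if x: "x \<in> ?S" for x
  proof -
    have x': "x \<in> {a..b}" using x sub by auto
    have bounds: "\<bar>f x\<bar> \<le> sup_norm a b f" "\<bar>g x\<bar> \<le> sup_norm a b g"
        "\<bar>f' x\<bar> \<le> sup_norm a b f'" "\<bar>g' x\<bar> \<le> sup_norm a b g'"
      by (rule abs_le_sup_norm; fact)+
    \<comment> \<open>Since \<open>f < g\<close>, at most one obstacle is violated at
      \<open>x\<close>. One of the two terms then bounds the difference, and the other is
      nonnegative.\<close>
    define F where "F = modulus a b f (t - s) + modulus a b f' (t - s) + \<bar>k\<bar> * (t - s)"
    define G where "G = modulus a b g (t - s) + modulus a b g' (t - s) + \<bar>k\<bar> * (t - s)"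
    have dFG: "d = C * F powr \<alpha> + C * G powr \<alpha>" by (simp add: d F_def G_def distrib_left)
    have nonneg: "0 \<le> C * F powr \<alpha>" "0 \<le> C * G powr \<alpha>" using \<open>C > 0\<close> by auto
    have M2': "sup_norm a b f' \<le> M2" "sup_norm a b g' \<le> M2" "0 \<le> M2"
      using bounds unfolding M2 by linarith+
    then have "sup_norm a b f' * (b - a) \<le> M2 * (b - a)" "sup_norm a b g' * (b - a) \<le> M2 * (b - a)"
      "0 \<le> M2 * (b - a)" using st by (auto intro!: mult_right_mono mult_nonneg_nonneg)
    then have M1': "sup_norm a b f \<le> M1" "sup_norm a b g \<le> M1"
        "sup_norm a b f + sup_norm a b f' * (b - a) \<le> M1"
        "sup_norm a b g + sup_norm a b g' * (b - a) \<le> M1"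
      unfolding M1 by linarith+
    \<comment> \<open>The first coordinates are equal, so only the distances in value and slope
      enter, which the chord lemmas estimate. The size conditions place both points in the box of
      the Hoelder condition.\<close>
    have H: "L (x, p, q) \<le> L (x, l x, k) + C * r powr \<alpha>"
      if "\<bar>p\<bar> \<le> M1" "\<bar>q\<bar> \<le> M2" "\<bar>l x\<bar> \<le> M1" "\<bar>k\<bar> \<le> M2" "\<bar>p - l x\<bar> + \<bar>q - k\<bar> \<le> r" for p q r
    proof -
      have "\<bar>L (x, p, q) - L (x, l x, k)\<bar> \<le> C * (\<bar>x - x\<bar> + \<bar>p - l x\<bar> + \<bar>q - k\<bar>) powr \<alpha>"
        by (rule holder[unfolded holder_on_def, rule_format])
          (use that(1-4) x' in \<open>auto simp: abs_le_iff\<close>)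
      also have "\<dots> \<le> C * r powr \<alpha>"
        using that(5) \<open>C > 0\<close> \<open>\<alpha> > 0\<close> by (intro mult_left_mono powr_mono2) auto
      finally show ?thesis by linarith
    qed
    have lx: "l x = u s + k * (x - s)" by (simp add: l_def)
    \<comment> \<open>The chord takes the values of \<open>u\<close> at \<open>s\<close> and
      \<open>t\<close>, and there \<open>u\<close> lies between the obstacles.\<close>
    have us: "f s \<le> u s" "u s \<le> g s" "f t \<le> u s + k * (t - s)" "u s + k * (t - s) \<le> g t"
      unfolding lt using u st by auto
    consider "l x < f x" | "\<not> l x < f x" "g x < l x" | "\<not> l x < f x" "\<not> g x < l x" by blast
    then show ?thesis
    proof cases
      case 1
      note * = chord_below_bounds[OF f f' st x us(1,3), folded lx F_def, OF _ 1]
      have "L (x, f x, f' x) \<le> L (x, l x, k) + C * F powr \<alpha>"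
        using * bounds M1' M2' by (intro H) linarith+
      then show ?thesis using 1 nonneg by (simp add: P_def dFG)
    next
      case 2
      note * = chord_above_bounds[OF g g' st x us(2,4), folded lx G_def, OF _ 2(2)]
      have "L (x, g x, g' x) \<le> L (x, l x, k) + C * G powr \<alpha>"
        using * bounds M1' M2' by (intro H) linarith+
      then show ?thesis using 2 nonneg by (simp add: P_def dFG)
    next
      case 3
      then show ?thesis using nonneg by (simp add: P_def dFG)
    qed
  qed

  have "energy L v a b \<le> energy L w a b + ereal (d * measure lebesgue ?S)"
    unfolding energy_def
    by (rule signed_nn_integral_mono[OF _ sub _ Pint AEv Lint AEw out le])
      (use st in \<open>auto intro: cl\<close>)
  then show ?thesis using st by (simp add: v_def w_def)
qed

section \<open>Comparison of the minimizer with the truncated replacement\<close>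

theorem lemma2p6:
  fixes a b A B c \<delta>0 C0 \<alpha>0 M1 M2 :: real
    and L :: "real \<times> real \<times> real \<Rightarrow> real"
    and f g f' g' u :: "real \<Rightarrow> real"
    and K :: "(real \<times> real) set"
    and \<omega> :: "real \<Rightarrow> real \<Rightarrow> real"
  assumes "a < b"
    and "continuous_on ({a..b} \<times> UNIV \<times> UNIV) L"
    and "locally_holder a b L"
    and "\<And>x. x \<in> {a..b} \<Longrightarrow> (f has_real_derivative f' x) (at x within {a..b})"
    and "continuous_on {a..b} f'"
    and "\<And>x. x \<in> {a..b} \<Longrightarrow> (g has_real_derivative g' x) (at x within {a..b})"
    and "continuous_on {a..b} g'"
    and "\<And>x. x \<in> {a..b} \<Longrightarrow> f x < g x"
    and "K = {(x, y). x \<in> {a..b} \<and> f x \<le> y \<and> y \<le> g x}"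
    and "u \<in> W11 a b"
    and "\<bar>energy L u a b\<bar> \<noteq> \<infinity>"
    and "c = \<bar>real_of_ereal (energy L u a b)\<bar> + 1"
    and "\<delta>0 > 0"
    and "M2 = max (sup_norm a b f') (sup_norm a b g')"
    and "M1 = max (sup_norm a b f) (sup_norm a b g) + M2 * (b - a)"
    and "C0 > 0" and "\<alpha>0 > 0"
    and "holder_on ({a..b} \<times> {-M1..M1} \<times> {-M2..M2}) L C0 \<alpha>0"
    and "\<omega> = (\<lambda>k \<epsilon>. C0 * ((modulus a b f \<epsilon> + modulus a b f' \<epsilon> + k * \<epsilon>) powr \<alpha>0
                         + (modulus a b g \<epsilon> + modulus a b g' \<epsilon> + k * \<epsilon>) powr \<alpha>0))"
    and "u \<in> admissible a b A B f g"
    and "\<And>v. v \<in> admissible a b A B f g \<Longrightarrow> energy L u a b \<le> energy L v a b"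
  shows "class_data a b \<omega> K c \<delta>0 \<and> u \<in> quasi_min_class a b \<omega> L K c \<delta>0"
proof -
  note f = assms(4) and g = assms(6)
  have cf: "continuous_on {a..b} f" and cg: "continuous_on {a..b} g"
    by (rule DERIV_continuous_on, erule f g)+
  have u: "f x \<le> u x \<and> u x \<le> g x" if "x \<in> {a..b}" for x
    using assms(20) that by (auto simp: admissible_def)
  have uAB: "u a = A" "u b = B" using assms(20) by (auto simp: admissible_def)
  have Wf: "f \<in> W11 a b"
    using C1_Lipschitz[OF f abs_le_sup_norm[OF assms(5)]] by (rule Lipschitz_W11)
  have Wg: "g \<in> W11 a b"
    using C1_Lipschitz[OF g abs_le_sup_norm[OF assms(7)]] by (rule Lipschitz_W11)

  have c: "c > 0" using assms(12) by linarith
  have "class_data a b \<omega> K c \<delta>0"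
    unfolding assms(9,19)
    by (rule class_data_modulus[OF _ cf assms(5) cg assms(7) c assms(13,16,17)])
      (use assms(1) in simp)
  moreover have "energy L u a b \<le> ereal c"
    using assms(11,12) by (cases "energy L u a b") auto
  moreover have "energy L u a b \<le> energy L (affine_repl u s t) a b
      + ereal (\<omega> \<bar>slope u s t\<bar> \<bar>s - t\<bar> * \<bar>s - t\<bar>)"
    if st: "s \<in> {a..b}" "t \<in> {a..b}" "s < t" for s t
  proof -
    let ?w = "affine_repl u s t"
    let ?v = "\<lambda>x. max (f x) (min (g x) (?w x))"
    have st': "a \<le> s" "s < t" "t \<le> b" "\<bar>s - t\<bar> = t - s" using st by auto
    have "?w \<in> W11 a b" by (rule affine_repl_W11[OF assms(10) st'(1-3)])
    with Wg have "(\<lambda>x. min (g x) (?w x)) \<in> W11 a b" by (rule W11_increment_le) linarith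
    with Wf have "?v \<in> W11 a b" by (rule W11_increment_le) linarith
    \<comment> \<open>Neither \<open>a\<close> nor \<open>b\<close> lies in \<open>]s,t[\<close>, so
      \<open>?w\<close> equals \<open>u\<close> there and truncation has no effect.\<close>
    moreover have "?v a = A" "?v b = B"
      using st' u[of a] u[of b] uAB assms(1) by (auto simp: affine_repl_def)
    \<comment> \<open>The bound \<open>?v \<le> g\<close> uses \<open>f < g\<close>, as the outer
      maximum could otherwise exceed \<open>g\<close>.\<close>
    ultimately have "?v \<in> admissible a b A B f g"
      using assms(8) by (force simp: admissible_def)
    then have "energy L u a b \<le> energy L ?v a b" by (rule assms(21))
    also have "\<dots> \<le> energy L ?w a b + ereal (\<omega> \<bar>slope u s t\<bar> (t - s) * (t - s))"
      by (rule energy_truncation_le[OF assms(2) f assms(5) g assms(7,8) u st'(1-3)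
            assms(14,15,16,17,18) refl])
        (simp_all add: assms(19))
    finally show ?thesis by (simp only: st'(4))
  qed
  ultimately show ?thesis
    unfolding quasi_min_class_def using assms(9,10) u by auto
qed

end
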